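(* Let $\mathbf{A}\in\mathbb{K}^{m\times n}$, $\mathbf{b}\in\mathbb{K}^m$, $\mathbf{c}\in\mathbb{K}^n$ be such that the strictly feasible set $\boldsymbol{\mathcal{F}}^\circ$ is non-empty. For every $\boldsymbol\mu\in\mathbb{K}$ with $\boldsymbol\mu>0$, the image under the valuation map of the point $\boldsymbol{\mathcal{C}}(\boldsymbol\mu)$ of the central path is $$\mathrm{val}(\boldsymbol{\mathcal{C}}(\boldsymbol\mu))=\text{barycenter of }\{z\in\mathrm{val}(\boldsymbol{\mathcal{F}}):\ \mathrm{tgap}(z)\le\mathrm{val}(\boldsymbol\mu)\},$$ where the barycenter of the set is its coordinatewise maximum (which exists and belongs to the set).
   Context: Field $\mathbb{K}$: absolutely convergent generalized real Puiseux series $f=\sum_{\alpha\in\mathbb{R}}a_\alpha t^\alpha$ with $a_\alpha\in\mathbb{R}$, whose support $\{\alpha:a_\alpha\ne0\}$ is finite or has $-\infty$ as only accumulation point, and which converge absolutely for all real $t>\rho$ for some $\rho>0$. $f>0$ iff its leading coefficient (at the largest exponent) is positive, equivalently $f(t)>0$ for all large $t$; this makes $\mathbb{K}$ a real closed ordered field; $\mathbb{K}_+$ is the set of nonnegative elements. $\mathrm{val}(f)\in\mathbb{R}\cup\{-\infty\}$ is the largest exponent in the support, $\mathrm{val}(0)=-\infty$; $\mathrm{val}$ acts entrywise on vectors and elementwise on sets. Primal-dual setting: $N=n+m$, $\boldsymbol{\mathcal{F}}=\{(x,w,s,y)\in\mathbb{K}_+^{n}\times\mathbb{K}_+^m\times\mathbb{K}_+^n\times\mathbb{K}_+^m:\mathbf{A}x+w=\mathbf{b},\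 s-\mathbf{A}^\top y=\mathbf{c}\}$ and $\boldsymbol{\mathcal{F}}^\circ=\{z\in\boldsymbol{\mathcal{F}}:z>0\}$. When $\boldsymbol{\mathcal{F}}^\circ\neq\emptyset$, for $\boldsymbol\mu\in\mathbb{K}$, $\boldsymbol\mu>0$, there is a unique point $\boldsymbol{\mathcal{C}}(\boldsymbol\mu)=(x,w,s,y)\in\boldsymbol{\mathcal{F}}^\circ$ with $x_js_j=\boldsymbol\mu$ for all $j\in[n]$ and $w_iy_i=\boldsymbol\mu$ for all $i\in[m]$. Tropical duality gap: for $z=(x,w,s,y)\in(\mathbb{R}\cup\{-\infty\})^{2N}$, $\mathrm{tgap}(z)=\max\bigl(\max_{j}(x_j+s_j),\max_i(w_i+y_i)\bigr)$. *)

theory Defs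
  imports "HOL-Analysis.Analysis"
begin

section \<open>The field of absolutely convergent generalized real Puiseux series\<close>

text \<open>
  A series \<open>\<Sum>\<alpha>. a \<alpha> t\<^sup>\<alpha>\<close> is represented by its coefficient function. The condition on the
  support is that it is finite or that its set of accumulation points in the extended reals
  is \<open>{-\<infinity>}\<close>.
\<close>

definition puiseux_support :: "real set \<Rightarrow> bool" where
  "puiseux_support S \<longleftrightarrow> finite S \<or> {x::ereal. x islimpt (ereal ` S)} = {-\<infinity>}"

definition is_puiseux :: "(real \<Rightarrow> real) \<Rightarrow> bool" where
  "is_puiseux a \<longleftrightarrow> puiseux_support {\<alpha>. a \<alpha> \<noteq> 0} \<and>
     (\<exists>\<rho>>0. \<forall>t>\<rho>. (\<lambda>\<alpha>. \<bar>a \<alpha> * t powr \<alpha>\<bar>) summable_on UNIV)"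

lemma puiseux_support_iff:
  "puiseux_support S \<longleftrightarrow> (\<forall>c. finite {\<alpha>\<in>S. c \<le> \<alpha>})"
proof
  assume S: "puiseux_support S"
  show "\<forall>c. finite {\<alpha>\<in>S. c \<le> \<alpha>}"
  proof (rule allI, rule ccontr)
    fix c assume inf: "infinite {\<alpha>\<in>S. c \<le> \<alpha>}"
    hence lim: "{x::ereal. x islimpt (ereal ` S)} = {-\<infinity>}"
      using S by (auto simp: puiseux_support_def)
    have "infinite (ereal ` {\<alpha>\<in>S. c \<le> \<alpha>})"
      using inf by (simp add: finite_image_iff inj_on_def)
    moreover have "compact {ereal c..}"
      using closed_Int_compact[OF closed_atLeast compact_UNIV] by simp
    moreover have "ereal ` {\<alpha>\<in>S. c \<le> \<alpha>} \<subseteq> {ereal c..}" by auto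
    ultimately have "\<exists>x\<in>{ereal c..}. x islimpt (ereal ` {\<alpha>\<in>S. c \<le> \<alpha>})"
      using Heine_Borel_imp_Bolzano_Weierstrass by blast
    then obtain x where x: "x \<in> {ereal c..}" "x islimpt (ereal ` {\<alpha>\<in>S. c \<le> \<alpha>})"
      by blast
    have "x islimpt (ereal ` S)"
      by (rule islimpt_subset[OF x(2)]) auto
    hence "x = -\<infinity>" using lim by auto
    thus False using x(1) by auto
  qed
next
  assume fin: "\<forall>c. finite {\<alpha>\<in>S. c \<le> \<alpha>}"
  show "puiseux_support S"
  proof (cases "finite S")
    case False
    have only: "x = -\<infinity>" if x: "x islimpt (ereal ` S)" for x :: ereal
    proof (rule ccontr)
      assume "x \<noteq> -\<infinity>"
      then obtain c where c: "ereal c < x"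
        using ereal_dense2[of "-\<infinity>" x] by auto
      have "x islimpt (ereal ` S \<inter> {ereal c<..})"
        unfolding islimpt_def
      proof safe
        fix T assume "x \<in> T" "open T"
        hence "x \<in> T \<inter> {ereal c<..}" "open (T \<inter> {ereal c<..})" using c by auto
        then obtain y where "y \<in> ereal ` S" "y \<in> T \<inter> {ereal c<..}" "y \<noteq> x"
          using x by (meson islimptE)
        thus "\<exists>y\<in>ereal ` S \<inter> {ereal c<..}. y \<in> T \<and> y \<noteq> x" by blast
      qed
      moreover have "finite (ereal ` S \<inter> {ereal c<..})"
      proof (rule finite_subset)
        show "ereal ` S \<inter> {ereal c<..} \<subseteq> ereal ` {\<alpha>\<in>S. c \<le> \<alpha>}" by auto
      qed (use fin in auto)
      ultimately show False by (simp add: islimpt_finite)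
    qed
    have "infinite (ereal ` S)"
      using False by (simp add: finite_image_iff inj_on_def)
    then obtain x where "x islimpt (ereal ` S)"
      using Heine_Borel_imp_Bolzano_Weierstrass[OF compact_UNIV, of "ereal ` S"] by auto
    thus ?thesis using only by (auto simp: puiseux_support_def)
  qed (simp add: puiseux_support_def)
qed

lemma puiseux_fin: "is_puiseux a \<Longrightarrow> finite {\<alpha>. a \<alpha> \<noteq> 0 \<and> c \<le> \<alpha>}"
  by (auto simp: is_puiseux_def puiseux_support_iff)

lemma puiseux_bdd:
  assumes "is_puiseux a"
  obtains M where "\<And>\<alpha>. a \<alpha> \<noteq> 0 \<Longrightarrow> \<alpha> \<le> M"
proof -
  let ?S = "insert 0 {\<alpha>. a \<alpha> \<noteq> 0 \<and> 0 \<le> \<alpha>}"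
  have "finite ?S" using puiseux_fin[OF assms] by simp
  hence "\<alpha> \<le> Max ?S" if "0 \<le> \<alpha>" "a \<alpha> \<noteq> 0" for \<alpha>
    using that by (intro Max_ge) auto
  moreover have "0 \<le> Max ?S" using \<open>finite ?S\<close> by (intro Max_ge) auto
  ultimately have "\<alpha> \<le> Max ?S" if "a \<alpha> \<noteq> 0" for \<alpha>
    using that by (meson linear order_trans)
  thus ?thesis using that by blast
qed

lemma is_puiseuxI:
  assumes "\<And>c. finite {\<alpha>. a \<alpha> \<noteq> 0 \<and> c \<le> \<alpha>}"
    and "\<rho> > 0" "\<And>t. t > \<rho> \<Longrightarrow> (\<lambda>\<alpha>. \<bar>a \<alpha> * t powr \<alpha>\<bar>) summable_on UNIV"
  shows "is_puiseux a"
  using assms by (auto simp: is_puiseux_def puiseux_support_iff)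

lemma is_puiseux_finite: "finite {\<alpha>. a \<alpha> \<noteq> 0} \<Longrightarrow> is_puiseux a"
proof (rule is_puiseuxI[of a 1])
  assume fin: "finite {\<alpha>. a \<alpha> \<noteq> 0}"
  show "finite {\<alpha>. a \<alpha> \<noteq> 0 \<and> c \<le> \<alpha>}" for c
    by (rule finite_subset[OF _ fin]) auto
  show "(\<lambda>\<alpha>. \<bar>a \<alpha> * t powr \<alpha>\<bar>) summable_on UNIV" for t
  proof -
    have "(\<lambda>\<alpha>. \<bar>a \<alpha> * t powr \<alpha>\<bar>) summable_on {\<alpha>. a \<alpha> \<noteq> 0}"
      using fin by simp
    thus ?thesis
      by (subst summable_on_cong_neutral[where T = "{\<alpha>. a \<alpha> \<noteq> 0}"]) auto
  qed
qed simp

lemma is_puiseux_add: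
  assumes a: "is_puiseux a" and b: "is_puiseux b"
  shows "is_puiseux (\<lambda>\<alpha>. a \<alpha> + b \<alpha>)"
proof -
  from a obtain r where r: "r > 0" "\<And>t. t > r \<Longrightarrow> (\<lambda>\<alpha>. \<bar>a \<alpha> * t powr \<alpha>\<bar>) summable_on UNIV"
    by (auto simp: is_puiseux_def)
  from b obtain s where s: "s > 0" "\<And>t. t > s \<Longrightarrow> (\<lambda>\<alpha>. \<bar>b \<alpha> * t powr \<alpha>\<bar>) summable_on UNIV"
    by (auto simp: is_puiseux_def)
  show ?thesis
  proof (rule is_puiseuxI[of _ "max r s"])
    fix c
    show "finite {\<alpha>. a \<alpha> + b \<alpha> \<noteq> 0 \<and> c \<le> \<alpha>}"
      by (rule finite_subset[OF _ finite_UnI[OF puiseux_fin[OF a, of c] puiseux_fin[OF b, of c]]]) auto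
  next
    fix t assume "t > max r s"
    hence "(\<lambda>\<alpha>. \<bar>a \<alpha> * t powr \<alpha>\<bar> + \<bar>b \<alpha> * t powr \<alpha>\<bar>) summable_on UNIV"
      using r s by (intro summable_on_add) auto
    thus "(\<lambda>\<alpha>. \<bar>(a \<alpha> + b \<alpha>) * t powr \<alpha>\<bar>) summable_on UNIV"
      by (rule summable_on_comparison_test)
        (auto simp: distrib_right intro: abs_triangle_ineq)
  qed (use r in auto)
qed

lemma is_puiseux_uminus: "is_puiseux a \<Longrightarrow> is_puiseux (\<lambda>\<alpha>. - a \<alpha>)"
  by (simp add: is_puiseux_def)

text \<open>The Cauchy product; for admissible series it has finitely many terms in each degree.\<close>

definition puiseux_conv :: "(real \<Rightarrow> real) \<Rightarrow> (real \<Rightarrow> real) \<Rightarrow> real \<Rightarrow> real" where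
  "puiseux_conv a b \<gamma> = (\<Sum>\<alpha> | a \<alpha> \<noteq> 0 \<and> b (\<gamma> - \<alpha>) \<noteq> 0. a \<alpha> * b (\<gamma> - \<alpha>))"

lemma puiseux_conv_superset:
  assumes "finite S" "\<And>\<alpha>. a \<alpha> \<noteq> 0 \<Longrightarrow> b (\<gamma> - \<alpha>) \<noteq> 0 \<Longrightarrow> \<alpha> \<in> S"
  shows "puiseux_conv a b \<gamma> = (\<Sum>\<alpha>\<in>S. a \<alpha> * b (\<gamma> - \<alpha>))"
  unfolding puiseux_conv_def
  by (rule sum.mono_neutral_left) (use assms in auto)

lemma puiseux_conv_finite:
  assumes "is_puiseux a" "is_puiseux b"
  shows "finite {\<alpha>. a \<alpha> \<noteq> 0 \<and> b (\<gamma> - \<alpha>) \<noteq> 0}"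
proof -
  obtain M where M: "\<And>\<alpha>. b \<alpha> \<noteq> 0 \<Longrightarrow> \<alpha> \<le> M" using puiseux_bdd[OF assms(2)] by blast
  show ?thesis
    by (rule finite_subset[OF _ puiseux_fin[OF assms(1), of "\<gamma> - M"]]) (use M in force)
qed

lemma puiseux_conv_nonzero:
  assumes "puiseux_conv a b \<gamma> \<noteq> 0"
  obtains \<alpha> \<beta> where "\<gamma> = \<alpha> + \<beta>" "a \<alpha> \<noteq> 0" "b \<beta> \<noteq> 0"
proof -
  have "{\<alpha>. a \<alpha> \<noteq> 0 \<and> b (\<gamma> - \<alpha>) \<noteq> 0} \<noteq> {}"
    using assms unfolding puiseux_conv_def by (metis sum.empty)
  then obtain \<alpha> where "a \<alpha> \<noteq> 0 \<and> b (\<gamma> - \<alpha>) \<noteq> 0" by blast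
  thus ?thesis using that[of \<alpha> "\<gamma> - \<alpha>"] by simp
qed

lemma puiseux_conv_norm:
  fixes t :: real
  assumes a: "is_puiseux a" and b: "is_puiseux b" and t: "t > 0"
    and A: "(\<lambda>\<alpha>. \<bar>a \<alpha> * t powr \<alpha>\<bar>) summable_on UNIV"
    and B: "(\<lambda>\<alpha>. \<bar>b \<alpha> * t powr \<alpha>\<bar>) summable_on UNIV"
  shows "(\<lambda>\<gamma>. \<bar>puiseux_conv a b \<gamma> * t powr \<gamma>\<bar>) summable_on UNIV"
    and "infsum (\<lambda>\<gamma>. \<bar>puiseux_conv a b \<gamma> * t powr \<gamma>\<bar>) UNIV \<le>
         infsum (\<lambda>\<alpha>. \<bar>a \<alpha> * t powr \<alpha>\<bar>) UNIV * infsum (\<lambda>\<alpha>. \<bar>b \<alpha> * t powr \<alpha>\<bar>) UNIV"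
proof -
  define u where "u = (\<lambda>\<alpha>. \<bar>a \<alpha> * t powr \<alpha>\<bar>)"
  define v where "v = (\<lambda>\<alpha>. \<bar>b \<alpha> * t powr \<alpha>\<bar>)"
  have u0: "u \<alpha> \<ge> 0" and v0: "v \<alpha> \<ge> 0" for \<alpha> by (auto simp: u_def v_def)
  have us: "u summable_on UNIV" and vs: "v summable_on UNIV" using A B by (auto simp: u_def v_def)
  have hs: "((\<lambda>\<beta>. u \<alpha> * v \<beta>) has_sum u \<alpha> * infsum v UNIV) UNIV" for \<alpha>
    by (intro has_sum_cmult_right has_sum_infsum vs)
  have S: "(\<lambda>(\<alpha>,\<beta>). u \<alpha> * v \<beta>) summable_on (UNIV \<times> UNIV)"
    by (rule summable_on_SigmaI[where g = "\<lambda>\<alpha>. u \<alpha> * infsum v UNIV"])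
      (use hs u0 v0 in \<open>auto intro!: summable_on_cmult_left us\<close>)
  have S_val: "infsum (\<lambda>(\<alpha>,\<beta>). u \<alpha> * v \<beta>) (UNIV \<times> UNIV) = infsum u UNIV * infsum v UNIV"
  proof -
    have "infsum (\<lambda>(\<alpha>,\<beta>). u \<alpha> * v \<beta>) (UNIV \<times> UNIV)
        = infsum (\<lambda>\<alpha>. infsum (\<lambda>\<beta>. u \<alpha> * v \<beta>) UNIV) UNIV"
      using infsum_Sigma_banach[OF S] by simp
    also have "\<dots> = infsum (\<lambda>\<alpha>. u \<alpha> * infsum v UNIV) UNIV"
      by (intro infsum_cong infsumI hs)
    also have "\<dots> = infsum u UNIV * infsum v UNIV"
      by (rule infsum_cmult_left) (use us in auto)
    finally show ?thesis .
  qed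
  have bij: "bij_betw (\<lambda>(\<gamma>,\<alpha>). (\<alpha>, \<gamma> - \<alpha>)) (UNIV \<times> UNIV) (UNIV \<times> (UNIV :: real set))"
    by (rule bij_betwI[where g = "\<lambda>(\<alpha>,\<beta>). (\<alpha> + \<beta>, \<alpha>)"]) auto
  have T: "(\<lambda>(\<gamma>,\<alpha>). u \<alpha> * v (\<gamma> - \<alpha>)) summable_on (UNIV \<times> UNIV)"
    using summable_on_reindex_bij_betw[OF bij, of "\<lambda>(\<alpha>,\<beta>). u \<alpha> * v \<beta>"] S
    by (simp add: case_prod_unfold)
  have T_val: "infsum (\<lambda>(\<gamma>,\<alpha>). u \<alpha> * v (\<gamma> - \<alpha>)) (UNIV \<times> UNIV) = infsum u UNIV * infsum v UNIV"
    using infsum_reindex_bij_betw[OF bij, of "\<lambda>(\<alpha>,\<beta>). u \<alpha> * v \<beta>"] S_val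
    by (simp add: case_prod_unfold)
  have T1: "(\<lambda>\<alpha>. u \<alpha> * v (\<gamma> - \<alpha>)) summable_on UNIV" for \<gamma>
    using summable_on_SigmaD1[OF T, of \<gamma>] by simp
  have T2: "(\<lambda>\<gamma>. infsum (\<lambda>\<alpha>. u \<alpha> * v (\<gamma> - \<alpha>)) UNIV) summable_on UNIV"
    using summable_on_SigmaD[OF T] T1 by simp
  have T2_val: "infsum (\<lambda>\<gamma>. infsum (\<lambda>\<alpha>. u \<alpha> * v (\<gamma> - \<alpha>)) UNIV) UNIV
      = infsum u UNIV * infsum v UNIV"
    using infsum_Sigma_banach[OF T] T_val by simp
  have le: "\<bar>puiseux_conv a b \<gamma> * t powr \<gamma>\<bar> \<le> infsum (\<lambda>\<alpha>. u \<alpha> * v (\<gamma> - \<alpha>)) UNIV" for \<gamma>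
  proof -
    let ?F = "{\<alpha>. a \<alpha> \<noteq> 0 \<and> b (\<gamma> - \<alpha>) \<noteq> 0}"
    have "\<bar>puiseux_conv a b \<gamma> * t powr \<gamma>\<bar> = \<bar>\<Sum>\<alpha>\<in>?F. a \<alpha> * b (\<gamma> - \<alpha>) * t powr \<gamma>\<bar>"
      by (simp add: puiseux_conv_def sum_distrib_right)
    also have "\<dots> \<le> (\<Sum>\<alpha>\<in>?F. \<bar>a \<alpha> * b (\<gamma> - \<alpha>) * t powr \<gamma>\<bar>)"
      by (rule sum_abs)
    also have "\<dots> = (\<Sum>\<alpha>\<in>?F. u \<alpha> * v (\<gamma> - \<alpha>))"
    proof (rule sum.cong)
      fix \<alpha>
      have "t powr \<gamma> = t powr \<alpha> * t powr (\<gamma> - \<alpha>)"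
        by (simp flip: powr_add)
      thus "\<bar>a \<alpha> * b (\<gamma> - \<alpha>) * t powr \<gamma>\<bar> = u \<alpha> * v (\<gamma> - \<alpha>)"
        by (simp add: u_def v_def abs_mult)
    qed simp
    also have "\<dots> \<le> infsum (\<lambda>\<alpha>. u \<alpha> * v (\<gamma> - \<alpha>)) UNIV"
      by (rule finite_sum_le_infsum[OF T1])
        (use u0 v0 puiseux_conv_finite[OF a b] in auto)
    finally show ?thesis .
  qed
  show *: "(\<lambda>\<gamma>. \<bar>puiseux_conv a b \<gamma> * t powr \<gamma>\<bar>) summable_on UNIV"
    by (rule summable_on_comparison_test[OF T2]) (use le in auto)
  show "infsum (\<lambda>\<gamma>. \<bar>puiseux_conv a b \<gamma> * t powr \<gamma>\<bar>) UNIV \<le>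
         infsum (\<lambda>\<alpha>. \<bar>a \<alpha> * t powr \<alpha>\<bar>) UNIV * infsum (\<lambda>\<alpha>. \<bar>b \<alpha> * t powr \<alpha>\<bar>) UNIV"
    using infsum_mono[OF * T2 le] T2_val by (simp add: u_def v_def)
qed

lemma is_puiseux_conv:
  assumes a: "is_puiseux a" and b: "is_puiseux b"
  shows "is_puiseux (puiseux_conv a b)"
proof -
  from a obtain r where r: "r > 0" "\<And>t. t > r \<Longrightarrow> (\<lambda>\<alpha>. \<bar>a \<alpha> * t powr \<alpha>\<bar>) summable_on UNIV"
    by (auto simp: is_puiseux_def)
  from b obtain s where s: "s > 0" "\<And>t. t > s \<Longrightarrow> (\<lambda>\<alpha>. \<bar>b \<alpha> * t powr \<alpha>\<bar>) summable_on UNIV"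
    by (auto simp: is_puiseux_def)
  obtain M where M: "\<And>\<alpha>. a \<alpha> \<noteq> 0 \<Longrightarrow> \<alpha> \<le> M" using puiseux_bdd[OF a] by blast
  obtain M' where M': "\<And>\<alpha>. b \<alpha> \<noteq> 0 \<Longrightarrow> \<alpha> \<le> M'" using puiseux_bdd[OF b] by blast
  show ?thesis
  proof (rule is_puiseuxI[of _ "max r s"])
    fix c
    let ?P = "{\<alpha>. a \<alpha> \<noteq> 0 \<and> c - M' \<le> \<alpha>} \<times> {\<beta>. b \<beta> \<noteq> 0 \<and> c - M \<le> \<beta>}"
    have "{\<gamma>. puiseux_conv a b \<gamma> \<noteq> 0 \<and> c \<le> \<gamma>} \<subseteq> (\<lambda>(\<alpha>,\<beta>). \<alpha> + \<beta>) ` ?P"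
    proof safe
      fix \<gamma> assume "puiseux_conv a b \<gamma> \<noteq> 0" "c \<le> \<gamma>"
      then obtain \<alpha> \<beta> where ab: "\<gamma> = \<alpha> + \<beta>" "a \<alpha> \<noteq> 0" "b \<beta> \<noteq> 0"
        using puiseux_conv_nonzero by blast
      hence "(\<alpha>,\<beta>) \<in> ?P" using M[OF ab(2)] M'[OF ab(3)] \<open>c \<le> \<gamma>\<close> by auto
      thus "\<gamma> \<in> (\<lambda>(\<alpha>,\<beta>). \<alpha> + \<beta>) ` ?P" using ab(1) by force
    qed
    moreover have "finite ?P" using puiseux_fin[OF a] puiseux_fin[OF b] by blast
    ultimately show "finite {\<gamma>. puiseux_conv a b \<gamma> \<noteq> 0 \<and> c \<le> \<gamma>}"
      by (meson finite_imageI finite_subset)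
  next
    fix t assume "t > max r s"
    thus "(\<lambda>\<gamma>. \<bar>puiseux_conv a b \<gamma> * t powr \<gamma>\<bar>) summable_on UNIV"
      using r s by (intro puiseux_conv_norm a b) auto
  qed (use r in auto)
qed

lemma puiseux_conv_commute: "puiseux_conv a b = puiseux_conv b a"
proof
  fix \<gamma>
  show "puiseux_conv a b \<gamma> = puiseux_conv b a \<gamma>"
    unfolding puiseux_conv_def
    by (rule sum.reindex_bij_witness[where i = "\<lambda>\<alpha>. \<gamma> - \<alpha>" and j = "\<lambda>\<alpha>. \<gamma> - \<alpha>"]) auto
qed

lemma puiseux_conv_add:
  assumes "is_puiseux a" "is_puiseux b" "is_puiseux c"
  shows "puiseux_conv (\<lambda>\<alpha>. a \<alpha> + b \<alpha>) c \<gamma> = puiseux_conv a c \<gamma> + puiseux_conv b c \<gamma>"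
proof -
  let ?S = "{\<alpha>. a \<alpha> \<noteq> 0 \<and> c (\<gamma> - \<alpha>) \<noteq> 0} \<union> {\<alpha>. b \<alpha> \<noteq> 0 \<and> c (\<gamma> - \<alpha>) \<noteq> 0}"
  have S: "finite ?S" using puiseux_conv_finite assms by blast
  have "puiseux_conv (\<lambda>\<alpha>. a \<alpha> + b \<alpha>) c \<gamma> = (\<Sum>\<alpha>\<in>?S. (a \<alpha> + b \<alpha>) * c (\<gamma> - \<alpha>))"
    by (rule puiseux_conv_superset[OF S]) auto
  moreover have "puiseux_conv a c \<gamma> = (\<Sum>\<alpha>\<in>?S. a \<alpha> * c (\<gamma> - \<alpha>))"
    by (rule puiseux_conv_superset[OF S]) auto
  moreover have "puiseux_conv b c \<gamma> = (\<Sum>\<alpha>\<in>?S. b \<alpha> * c (\<gamma> - \<alpha>))"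
    by (rule puiseux_conv_superset[OF S]) auto
  ultimately show ?thesis by (simp add: distrib_right sum.distrib)
qed

lemma puiseux_conv_single:
  "puiseux_conv (\<lambda>\<alpha>. if \<alpha> = \<delta> then r else 0) b \<gamma> = r * b (\<gamma> - \<delta>)"
  by (subst puiseux_conv_superset[of "{\<delta>}"]) (auto split: if_splits)

lemma puiseux_conv_assoc:
  assumes a: "is_puiseux a" and b: "is_puiseux b" and c: "is_puiseux c"
  shows "puiseux_conv (puiseux_conv a b) c \<gamma> = puiseux_conv a (puiseux_conv b c) \<gamma>"
proof -
  obtain Ma where Ma: "\<And>\<alpha>. a \<alpha> \<noteq> 0 \<Longrightarrow> \<alpha> \<le> Ma" using puiseux_bdd[OF a] by blast
  obtain Mb where Mb: "\<And>\<alpha>. b \<alpha> \<noteq> 0 \<Longrightarrow> \<alpha> \<le> Mb" using puiseux_bdd[OF b] by blast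
  obtain Mc where Mc: "\<And>\<alpha>. c \<alpha> \<noteq> 0 \<Longrightarrow> \<alpha> \<le> Mc" using puiseux_bdd[OF c] by blast
  define A where "A = {\<alpha>. a \<alpha> \<noteq> 0 \<and> \<gamma> - Mb - Mc \<le> \<alpha>}"
  define B where "B = {\<beta>. b \<beta> \<noteq> 0 \<and> \<gamma> - Ma - Mc \<le> \<beta>}"
  define S where "S = (\<lambda>(\<alpha>,\<beta>). \<alpha> + \<beta>) ` (A \<times> B)"
  have fA: "finite A" and fB: "finite B"
    using puiseux_fin[OF a] puiseux_fin[OF b] by (auto simp: A_def B_def)
  hence fS: "finite S" by (auto simp: S_def)
  have "puiseux_conv (puiseux_conv a b) c \<gamma> = (\<Sum>\<beta>\<in>S. puiseux_conv a b \<beta> * c (\<gamma> - \<beta>))"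
  proof (rule puiseux_conv_superset[OF fS])
    fix \<beta> assume "puiseux_conv a b \<beta> \<noteq> 0" and g: "c (\<gamma> - \<beta>) \<noteq> 0"
    then obtain \<alpha> \<alpha>' where x: "\<beta> = \<alpha> + \<alpha>'" "a \<alpha> \<noteq> 0" "b \<alpha>' \<noteq> 0"
      using puiseux_conv_nonzero by blast
    hence "\<alpha> \<in> A" "\<alpha>' \<in> B"
      using Ma[OF x(2)] Mb[OF x(3)] Mc[OF g] by (auto simp: A_def B_def)
    thus "\<beta> \<in> S" using x(1) by (force simp: S_def)
  qed
  also have "\<dots> = (\<Sum>\<beta>\<in>S. \<Sum>\<alpha>\<in>A. a \<alpha> * b (\<beta> - \<alpha>) * c (\<gamma> - \<beta>))"
  proof (rule sum.cong[OF refl])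
    fix \<beta>
    show "puiseux_conv a b \<beta> * c (\<gamma> - \<beta>) = (\<Sum>\<alpha>\<in>A. a \<alpha> * b (\<beta> - \<alpha>) * c (\<gamma> - \<beta>))"
    proof (cases "c (\<gamma> - \<beta>) = 0")
      case False
      have "puiseux_conv a b \<beta> = (\<Sum>\<alpha>\<in>A. a \<alpha> * b (\<beta> - \<alpha>))"
      proof (rule puiseux_conv_superset[OF fA])
        fix \<alpha> assume "a \<alpha> \<noteq> 0" "b (\<beta> - \<alpha>) \<noteq> 0"
        thus "\<alpha> \<in> A" using Mb[of "\<beta> - \<alpha>"] Mc[OF False] by (auto simp: A_def)
      qed
      thus ?thesis by (simp add: sum_distrib_right)
    qed simp
  qed
  also have "\<dots> = (\<Sum>\<alpha>\<in>A. \<Sum>\<beta>\<in>S. a \<alpha> * b (\<beta> - \<alpha>) * c (\<gamma> - \<beta>))"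
    by (rule sum.swap)
  also have "\<dots> = (\<Sum>\<alpha>\<in>A. a \<alpha> * puiseux_conv b c (\<gamma> - \<alpha>))"
  proof (rule sum.cong[OF refl])
    fix \<alpha> assume \<alpha>: "\<alpha> \<in> A"
    have "(\<Sum>\<beta>\<in>S. a \<alpha> * b (\<beta> - \<alpha>) * c (\<gamma> - \<beta>))
        = (\<Sum>\<beta>\<in>(\<lambda>\<beta>. \<alpha> + \<beta>) ` B. a \<alpha> * b (\<beta> - \<alpha>) * c (\<gamma> - \<beta>))"
    proof (rule sum.mono_neutral_right[OF fS])
      show "(\<lambda>\<beta>. \<alpha> + \<beta>) ` B \<subseteq> S" using \<alpha> by (force simp: S_def)
      show "\<forall>\<beta>\<in>S - (\<lambda>\<beta>. \<alpha> + \<beta>) ` B. a \<alpha> * b (\<beta> - \<alpha>) * c (\<gamma> - \<beta>) = 0"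
      proof (rule ballI, rule ccontr)
        fix \<beta> assume \<beta>: "\<beta> \<in> S - (\<lambda>\<beta>. \<alpha> + \<beta>) ` B" and "a \<alpha> * b (\<beta> - \<alpha>) * c (\<gamma> - \<beta>) \<noteq> 0"
        hence "a \<alpha> \<noteq> 0" "b (\<beta> - \<alpha>) \<noteq> 0" "c (\<gamma> - \<beta>) \<noteq> 0" by auto
        hence "\<beta> - \<alpha> \<in> B" using Ma[of \<alpha>] Mc[of "\<gamma> - \<beta>"] by (auto simp: B_def)
        hence "\<alpha> + (\<beta> - \<alpha>) \<in> (\<lambda>\<beta>. \<alpha> + \<beta>) ` B" by blast
        thus False using \<beta> by simp
      qed
    qed
    also have "\<dots> = (\<Sum>\<beta>\<in>B. a \<alpha> * (b \<beta> * c (\<gamma> - \<alpha> - \<beta>)))"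
      by (subst sum.reindex) (auto simp: inj_on_def algebra_simps)
    also have "\<dots> = a \<alpha> * (\<Sum>\<beta>\<in>B. b \<beta> * c (\<gamma> - \<alpha> - \<beta>))"
      by (simp add: sum_distrib_left)
    also have "(\<Sum>\<beta>\<in>B. b \<beta> * c (\<gamma> - \<alpha> - \<beta>)) = puiseux_conv b c (\<gamma> - \<alpha>)"
    proof (rule puiseux_conv_superset[OF fB, symmetric])
      fix \<beta> assume "b \<beta> \<noteq> 0" "c (\<gamma> - \<alpha> - \<beta>) \<noteq> 0"
      thus "\<beta> \<in> B" using \<alpha> Ma[of \<alpha>] Mc[of "\<gamma> - \<alpha> - \<beta>"] by (auto simp: A_def B_def)
    qed
    finally show "(\<Sum>\<beta>\<in>S. a \<alpha> * b (\<beta> - \<alpha>) * c (\<gamma> - \<beta>)) = a \<alpha> * puiseux_conv b c (\<gamma> - \<alpha>)" .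
  qed
  also have "\<dots> = puiseux_conv a (puiseux_conv b c) \<gamma>"
  proof (rule puiseux_conv_superset[OF fA, symmetric])
    fix \<alpha> assume al: "a \<alpha> \<noteq> 0" and "puiseux_conv b c (\<gamma> - \<alpha>) \<noteq> 0"
    then obtain \<beta> \<beta>' where x: "\<gamma> - \<alpha> = \<beta> + \<beta>'" "b \<beta> \<noteq> 0" "c \<beta>' \<noteq> 0"
      using puiseux_conv_nonzero by blast
    thus "\<alpha> \<in> A" using al Mb[OF x(2)] Mc[OF x(3)] by (auto simp: A_def)
  qed
  finally show ?thesis .
qed

typedef puiseux = "{a. is_puiseux a}"
  morphisms pcoeff Abs_puiseux
  using is_puiseux_finite[of "\<lambda>_. 0"] by auto

setup_lifting type_definition_puiseux

lemma is_puiseux_pcoeff [simp]: "is_puiseux (pcoeff f)"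
  using pcoeff by simp

lemma puiseux_eqI: "(\<And>\<alpha>. pcoeff f \<alpha> = pcoeff g \<alpha>) \<Longrightarrow> f = g"
  by transfer auto

instantiation puiseux :: comm_ring_1
begin

lift_definition zero_puiseux :: puiseux is "\<lambda>_. 0"
  by (rule is_puiseux_finite) simp

lift_definition one_puiseux :: puiseux is "\<lambda>\<alpha>. if \<alpha> = 0 then 1 else 0"
  by (rule is_puiseux_finite) simp

lift_definition plus_puiseux :: "puiseux \<Rightarrow> puiseux \<Rightarrow> puiseux" is "\<lambda>a b \<alpha>. a \<alpha> + b \<alpha>"
  by (rule is_puiseux_add)

lift_definition uminus_puiseux :: "puiseux \<Rightarrow> puiseux" is "\<lambda>a \<alpha>. - a \<alpha>"
  by (rule is_puiseux_uminus)

lift_definition minus_puiseux :: "puiseux \<Rightarrow> puiseux \<Rightarrow> puiseux" is "\<lambda>a b \<alpha>. a \<alpha> - b \<alpha>"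
  using is_puiseux_add[OF _ is_puiseux_uminus] by simp

lift_definition times_puiseux :: "puiseux \<Rightarrow> puiseux \<Rightarrow> puiseux" is puiseux_conv
  by (rule is_puiseux_conv)

instance
proof
  fix f g h :: puiseux
  show "f + g + h = f + (g + h)" "f + g = g + f" "0 + f = f" "- f + f = 0" "f - g = f + - g"
    by (transfer; auto)+
  show "f * g * h = f * (g * h)"
    by transfer (auto simp: puiseux_conv_assoc)
  show "f * g = g * f"
    by transfer (rule puiseux_conv_commute)
  show "1 * f = f"
    by transfer (auto simp: puiseux_conv_single)
  show "(f + g) * h = f * h + g * h"
    by transfer (auto simp: puiseux_conv_add)
  show "(0::puiseux) \<noteq> 1"
    by transfer (auto simp: fun_eq_iff)
qed

end

lemma pcoeff_simps [simp]:
  "pcoeff 0 \<alpha> = 0" "pcoeff 1 \<alpha> = (if \<alpha> = 0 then 1 else 0)"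
  "pcoeff (f + g) \<alpha> = pcoeff f \<alpha> + pcoeff g \<alpha>" "pcoeff (- f) \<alpha> = - pcoeff f \<alpha>"
  "pcoeff (f - g) \<alpha> = pcoeff f \<alpha> - pcoeff g \<alpha>"
  by (transfer; simp)+

lemma pcoeff_mult: "pcoeff (f * g) = puiseux_conv (pcoeff f) (pcoeff g)"
  by transfer simp

text \<open>The largest exponent in the support (meaningful for nonzero series only).\<close>

definition lead_exp :: "puiseux \<Rightarrow> real" where
  "lead_exp f = (GREATEST \<alpha>. pcoeff f \<alpha> \<noteq> 0)"

definition puiseux_pos :: "puiseux \<Rightarrow> bool" where
  "puiseux_pos f \<longleftrightarrow> f \<noteq> 0 \<and> pcoeff f (lead_exp f) > 0"

lemma lead_exp:
  assumes "f \<noteq> 0"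
  shows "pcoeff f (lead_exp f) \<noteq> 0" and "\<And>\<alpha>. pcoeff f \<alpha> \<noteq> 0 \<Longrightarrow> \<alpha> \<le> lead_exp f"
proof -
  obtain \<alpha>0 where \<alpha>0: "pcoeff f \<alpha>0 \<noteq> 0"
    using assms puiseux_eqI[of f 0] by auto
  let ?S = "{\<alpha>. pcoeff f \<alpha> \<noteq> 0 \<and> \<alpha>0 \<le> \<alpha>}"
  have fin: "finite ?S" by (rule puiseux_fin) simp
  have ne: "?S \<noteq> {}" using \<alpha>0 by auto
  have m: "pcoeff f (Max ?S) \<noteq> 0" using Max_in[OF fin ne] by auto
  have le: "\<alpha> \<le> Max ?S" if "pcoeff f \<alpha> \<noteq> 0" for \<alpha>
  proof (cases "\<alpha>0 \<le> \<alpha>")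
    case True thus ?thesis using that fin by (intro Max_ge) auto
  next
    case False
    moreover have "\<alpha>0 \<le> Max ?S" using Max_in[OF fin ne] by auto
    ultimately show ?thesis by linarith
  qed
  have "lead_exp f = Max ?S"
    unfolding lead_exp_def by (rule Greatest_equality) (use m le in auto)
  thus "pcoeff f (lead_exp f) \<noteq> 0" "\<And>\<alpha>. pcoeff f \<alpha> \<noteq> 0 \<Longrightarrow> \<alpha> \<le> lead_exp f"
    using m le by auto
qed

lemma lead_exp_eqI:
  assumes "pcoeff f \<delta> \<noteq> 0" "\<And>\<alpha>. \<alpha> > \<delta> \<Longrightarrow> pcoeff f \<alpha> = 0"
  shows "lead_exp f = \<delta>"
  unfolding lead_exp_def
  by (rule Greatest_equality) (use assms in \<open>auto simp: not_le[symmetric]\<close>)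

lemma puiseux_pos_iff:
  "puiseux_pos f \<longleftrightarrow> (\<exists>\<delta>. pcoeff f \<delta> > 0 \<and> (\<forall>\<alpha>>\<delta>. pcoeff f \<alpha> = 0))"
proof
  assume "puiseux_pos f"
  thus "\<exists>\<delta>. pcoeff f \<delta> > 0 \<and> (\<forall>\<alpha>>\<delta>. pcoeff f \<alpha> = 0)"
    using lead_exp[of f] by (intro exI[of _ "lead_exp f"]) (force simp: puiseux_pos_def)
next
  assume "\<exists>\<delta>. pcoeff f \<delta> > 0 \<and> (\<forall>\<alpha>>\<delta>. pcoeff f \<alpha> = 0)"
  then obtain \<delta> where d: "pcoeff f \<delta> > 0" "\<forall>\<alpha>>\<delta>. pcoeff f \<alpha> = 0" by blast
  hence "lead_exp f = \<delta>" by (intro lead_exp_eqI) auto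
  thus "puiseux_pos f" using d by (auto simp: puiseux_pos_def)
qed

lemma puiseux_pos_add:
  assumes "puiseux_pos f" "puiseux_pos g"
  shows "puiseux_pos (f + g)"
proof -
  obtain d e where d: "pcoeff f d > 0" "\<forall>\<alpha>>d. pcoeff f \<alpha> = 0"
    and e: "pcoeff g e > 0" "\<forall>\<alpha>>e. pcoeff g \<alpha> = 0"
    using assms by (auto simp: puiseux_pos_iff)
  have "pcoeff (f + g) (max d e) > 0"
    using d e by (cases d e rule: linorder_cases) (auto simp: max_def add_pos_pos)
  moreover have "pcoeff (f + g) \<alpha> = 0" if "\<alpha> > max d e" for \<alpha>
    using that d e by simp
  ultimately show ?thesis unfolding puiseux_pos_iff by blast
qed

lemma pcoeff_mult_lead:
  assumes d: "\<And>\<alpha>. \<alpha> > d \<Longrightarrow> pcoeff f \<alpha> = 0" and e: "\<And>\<alpha>. \<alpha> > e \<Longrightarrow> pcoeff g \<alpha> = 0"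
  shows "pcoeff (f * g) (d + e) = pcoeff f d * pcoeff g e"
    and "\<And>\<alpha>. \<alpha> > d + e \<Longrightarrow> pcoeff (f * g) \<alpha> = 0"
proof -
  have "\<alpha> = d" if "pcoeff f \<alpha> \<noteq> 0" "pcoeff g (d + e - \<alpha>) \<noteq> 0" for \<alpha>
  proof (rule ccontr)
    assume "\<alpha> \<noteq> d"
    hence "\<alpha> > d \<or> d + e - \<alpha> > e" by linarith
    thus False using that d e by blast
  qed
  thus "pcoeff (f * g) (d + e) = pcoeff f d * pcoeff g e"
    by (subst pcoeff_mult, subst puiseux_conv_superset[of "{d}"]) auto
  fix \<alpha> assume \<alpha>: "\<alpha> > d + e"
  show "pcoeff (f * g) \<alpha> = 0"
  proof (rule ccontr)
    assume "pcoeff (f * g) \<alpha> \<noteq> 0"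
    then obtain x y where xy: "\<alpha> = x + y" "pcoeff f x \<noteq> 0" "pcoeff g y \<noteq> 0"
      unfolding pcoeff_mult using puiseux_conv_nonzero by blast
    hence "x \<le> d" "y \<le> e" using d e by (meson not_le)+
    thus False using xy(1) \<alpha> by linarith
  qed
qed

lemma puiseux_pos_mult:
  assumes "puiseux_pos f" "puiseux_pos g"
  shows "puiseux_pos (f * g)"
proof -
  obtain d e where d: "pcoeff f d > 0" "\<forall>\<alpha>>d. pcoeff f \<alpha> = 0"
    and e: "pcoeff g e > 0" "\<forall>\<alpha>>e. pcoeff g \<alpha> = 0"
    using assms by (auto simp: puiseux_pos_iff)
  show ?thesis unfolding puiseux_pos_iff
    using pcoeff_mult_lead[of d f e g] d e by (metis mult_pos_pos)
qed

lemma puiseux_pos_cases: "puiseux_pos f \<or> f = 0 \<or> puiseux_pos (- f)"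
proof (cases "f = 0")
  case False
  note L = lead_exp[OF False]
  have "pcoeff f \<alpha> = 0" if "\<alpha> > lead_exp f" for \<alpha> using L(2)[of \<alpha>] that by auto
  thus ?thesis using L(1) unfolding puiseux_pos_iff
    by (cases "pcoeff f (lead_exp f) > 0") (auto intro!: exI[of _ "lead_exp f"])
qed simp

lemma puiseux_pos_uminus: "puiseux_pos f \<Longrightarrow> \<not> puiseux_pos (- f)"
  using puiseux_pos_add[of f "- f"] by (auto simp: puiseux_pos_def)

instantiation puiseux :: linordered_idom
begin

definition less_puiseux :: "puiseux \<Rightarrow> puiseux \<Rightarrow> bool" where
  "f < g \<longleftrightarrow> puiseux_pos (g - f)"

definition less_eq_puiseux :: "puiseux \<Rightarrow> puiseux \<Rightarrow> bool" where
  "f \<le> g \<longleftrightarrow> f = g \<or> puiseux_pos (g - f)"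

definition abs_puiseux :: "puiseux \<Rightarrow> puiseux" where
  "\<bar>f :: puiseux\<bar> = (if f < 0 then - f else f)"

definition sgn_puiseux :: "puiseux \<Rightarrow> puiseux" where
  "sgn (f :: puiseux) = (if f = 0 then 0 else if 0 < f then 1 else - 1)"

instance
proof
  fix f g h :: puiseux
  show "f < g \<longleftrightarrow> f \<le> g \<and> \<not> g \<le> f"
    using puiseux_pos_uminus[of "g - f"]
    by (auto simp: less_puiseux_def less_eq_puiseux_def puiseux_pos_def)
  show "f \<le> f" by (simp add: less_eq_puiseux_def)
  show "f \<le> g \<Longrightarrow> g \<le> h \<Longrightarrow> f \<le> h"
    using puiseux_pos_add[of "g - f" "h - g"] by (auto simp: less_eq_puiseux_def)
  show "f \<le> g \<Longrightarrow> g \<le> f \<Longrightarrow> f = g"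
    using puiseux_pos_uminus[of "g - f"] by (auto simp: less_eq_puiseux_def)
  show "f \<le> g \<or> g \<le> f"
    using puiseux_pos_cases[of "g - f"] by (auto simp: less_eq_puiseux_def)
  show "f \<le> g \<Longrightarrow> h + f \<le> h + g" by (auto simp: less_eq_puiseux_def)
  show "f < g \<Longrightarrow> 0 < h \<Longrightarrow> h * f < h * g"
    using puiseux_pos_mult[of h "g - f"] by (auto simp: less_puiseux_def right_diff_distrib)
  show "\<bar>f\<bar> = (if f < 0 then - f else f)" by (simp add: abs_puiseux_def)
  show "sgn f = (if f = 0 then 0 else if 0 < f then 1 else - 1)" by (simp add: sgn_puiseux_def)
qed

end

lift_definition monomial :: "real \<Rightarrow> real \<Rightarrow> puiseux" is "\<lambda>r \<delta> \<alpha>. if \<alpha> = \<delta> then r else 0"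
  by (rule is_puiseux_finite) simp

lemma pcoeff_monomial: "pcoeff (monomial r \<delta>) \<alpha> = (if \<alpha> = \<delta> then r else 0)"
  by transfer simp

lemma pcoeff_monomial_mult: "pcoeff (monomial r \<delta> * f) \<gamma> = r * pcoeff f (\<gamma> - \<delta>)"
  by transfer (simp add: puiseux_conv_single)

lemma pcoeff_sum: "pcoeff (sum f A) \<alpha> = (\<Sum>i\<in>A. pcoeff (f i) \<alpha>)"
  by (induction A rule: infinite_finite_induct) auto

text \<open>Inverses exist by the geometric series \<open>1 / (1 - g) = \<Sum>k. g ^ k\<close> for \<open>g\<close> infinitesimal.\<close>

lemma puiseux_geometric:
  assumes \<epsilon>: "\<epsilon> > 0" and g: "\<And>\<alpha>. pcoeff g \<alpha> \<noteq> 0 \<Longrightarrow> \<alpha> \<le> - \<epsilon>"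
  shows "\<exists>h. (1 - g) * h = 1"
proof -
  have pow_supp: "\<alpha> \<le> - real k * \<epsilon>" if "pcoeff (g ^ k) \<alpha> \<noteq> 0" for k \<alpha>
    using that
  proof (induction k arbitrary: \<alpha>)
    case (Suc k)
    then obtain x y where xy: "\<alpha> = x + y" "pcoeff g x \<noteq> 0" "pcoeff (g ^ k) y \<noteq> 0"
      by (auto simp: pcoeff_mult elim: puiseux_conv_nonzero)
    thus ?case using g[OF xy(2)] Suc.IH[OF xy(3)] by (simp add: algebra_simps)
  qed (auto split: if_splits)
  define N where "N = (\<lambda>\<gamma>. nat \<lceil>- \<gamma> / \<epsilon>\<rceil>)"
  have N: "pcoeff (g ^ k) \<alpha> = 0" if "k > N \<gamma>" "\<alpha> \<ge> \<gamma>" for k \<gamma> \<alpha>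
  proof (rule ccontr)
    assume "pcoeff (g ^ k) \<alpha> \<noteq> 0"
    hence "real k * \<epsilon> \<le> - \<gamma>" using pow_supp[of k \<alpha>] that by simp
    hence "real k \<le> - \<gamma> / \<epsilon>" using \<epsilon> by (simp only: pos_le_divide_eq)
    thus False using that(1) unfolding N_def by linarith
  qed
  define a where "a = (\<lambda>\<gamma>. \<Sum>k\<le>N \<gamma>. pcoeff (g ^ k) \<gamma>)"
  have a_eq: "a \<gamma>' = (\<Sum>k\<le>K. pcoeff (g ^ k) \<gamma>')" if "K \<ge> N \<gamma>" "\<gamma>' \<ge> \<gamma>" for \<gamma> \<gamma>' K
  proof -
    have "N \<gamma>' \<le> K"
    proof -
      have "- \<gamma>' / \<epsilon> \<le> - \<gamma> / \<epsilon>" using \<epsilon> that by (simp add: divide_right_mono)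
      hence "N \<gamma>' \<le> N \<gamma>" unfolding N_def by (intro nat_mono ceiling_mono)
      thus ?thesis using that by simp
    qed
    thus ?thesis unfolding a_def
      by (intro sum.mono_neutral_left) (auto intro: N[of \<gamma>'])
  qed
  have "is_puiseux (pcoeff g)" by simp
  then obtain r where r: "r > 0" "\<And>t. t > r \<Longrightarrow> (\<lambda>\<alpha>. \<bar>pcoeff g \<alpha> * t powr \<alpha>\<bar>) summable_on UNIV"
    unfolding is_puiseux_def by blast
  define t0 where "t0 = r + 1"
  have t0: "t0 > 0" "(\<lambda>\<alpha>. \<bar>pcoeff g \<alpha> * t0 powr \<alpha>\<bar>) summable_on UNIV"
    using r by (auto simp: t0_def)
  define C where "C = infsum (\<lambda>\<alpha>. \<bar>pcoeff g \<alpha> * t0 powr \<alpha>\<bar>) UNIV"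
  have C0: "C \<ge> 0" unfolding C_def by (rule infsum_nonneg) auto
  define \<rho> where "\<rho> = t0 * (1 + C) powr (1 / \<epsilon>)"
  have \<rho>0: "\<rho> > 0" using t0 C0 by (simp add: \<rho>_def)
  have a_sum: "(\<lambda>\<alpha>. \<bar>a \<alpha> * t powr \<alpha>\<bar>) summable_on UNIV" if t: "t > \<rho>" for t
  proof -
    have t_pos: "t > 0" using t \<rho>0 by simp
    define q where "q = (t / t0) powr (- \<epsilon>)"
    have tq: "t / t0 > (1 + C) powr (1 / \<epsilon>)"
      using t t0 by (simp add: \<rho>_def field_simps)
    have one_le: "(1 + C) powr (1 / \<epsilon>) \<ge> 1" using C0 \<epsilon> by (intro ge_one_powr_ge_zero) auto
    have "(t / t0) powr \<epsilon> > ((1 + C) powr (1 / \<epsilon>)) powr \<epsilon>"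
      using tq \<epsilon> by (intro powr_less_mono2) auto
    also have "((1 + C) powr (1 / \<epsilon>)) powr \<epsilon> = 1 + C"
      using \<epsilon> C0 by (simp add: powr_powr)
    finally have *: "(t / t0) powr \<epsilon> > 1 + C" .
    have "C / (t / t0) powr \<epsilon> < 1"
      using * C0 by (subst pos_divide_less_eq) linarith+
    hence q: "C * q < 1"
      by (simp only: q_def powr_minus divide_inverse)
    have le: "\<bar>pcoeff g \<alpha> * t powr \<alpha>\<bar> \<le> \<bar>pcoeff g \<alpha> * t0 powr \<alpha>\<bar> * q" for \<alpha>
    proof (cases "pcoeff g \<alpha> = 0")
      case False
      have "t powr \<alpha> = t0 powr \<alpha> * (t / t0) powr \<alpha>"
        using t_pos t0 by (simp add: powr_divide)
      moreover have "(t / t0) powr \<alpha> \<le> q"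
        unfolding q_def using g[OF False] tq one_le by (intro powr_mono) auto
      ultimately show ?thesis by (simp add: abs_mult mult.assoc mult_left_mono)
    qed simp
    have s0: "(\<lambda>\<alpha>. \<bar>pcoeff g \<alpha> * t0 powr \<alpha>\<bar> * q) summable_on UNIV"
      by (rule summable_on_cmult_left[OF t0(2)])
    have sg: "(\<lambda>\<alpha>. \<bar>pcoeff g \<alpha> * t powr \<alpha>\<bar>) summable_on UNIV"
      by (rule summable_on_comparison_test[OF s0]) (use le in auto)
    define D where "D = infsum (\<lambda>\<alpha>. \<bar>pcoeff g \<alpha> * t powr \<alpha>\<bar>) UNIV"
    have "D \<le> C * q"
      unfolding D_def C_def using infsum_mono[OF sg s0 le] t0(2)
      by (simp add: infsum_cmult_left)
    hence D1: "D < 1" using q by simp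
    have D0: "D \<ge> 0" unfolding D_def by (rule infsum_nonneg) auto
    have pow: "(\<lambda>\<alpha>. \<bar>pcoeff (g ^ k) \<alpha> * t powr \<alpha>\<bar>) summable_on UNIV \<and>
        infsum (\<lambda>\<alpha>. \<bar>pcoeff (g ^ k) \<alpha> * t powr \<alpha>\<bar>) UNIV \<le> D ^ k" for k
    proof (induction k)
      case 0
      have eq: "(\<lambda>\<alpha>. \<bar>pcoeff (g ^ 0) \<alpha> * t powr \<alpha>\<bar>) = (\<lambda>\<alpha>. if \<alpha> = 0 then 1 else 0)"
        using t_pos by auto
      have "((\<lambda>\<alpha>::real. if \<alpha> = 0 then 1 else (0::real)) has_sum 1) UNIV"
        by (rule has_sum_finite_neutralI[of "{0}"]) auto
      thus ?case unfolding eq by (auto simp: infsumI has_sum_imp_summable)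
    next
      case (Suc k)
      note n = puiseux_conv_norm[OF is_puiseux_pcoeff[of g] is_puiseux_pcoeff[of "g ^ k"] t_pos sg
          conjunct1[OF Suc.IH]]
      have "D * infsum (\<lambda>\<alpha>. \<bar>pcoeff (g ^ k) \<alpha> * t powr \<alpha>\<bar>) UNIV \<le> D * D ^ k"
        using Suc.IH D0 by (intro mult_left_mono) auto
      thus ?case using n by (simp add: pcoeff_mult D_def)
    qed
    show ?thesis
    proof (rule nonneg_bdd_above_summable_on)
      show "bdd_above (sum (\<lambda>\<alpha>. \<bar>a \<alpha> * t powr \<alpha>\<bar>) ` {F. F \<subseteq> UNIV \<and> finite F})"
      proof (rule bdd_aboveI2)
        fix F assume "F \<in> {F :: real set. F \<subseteq> UNIV \<and> finite F}"
        hence F: "finite F" by simp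
        define c where "c = Min (insert 0 F)"
        have c: "\<alpha> \<ge> c" if "\<alpha> \<in> F" for \<alpha> unfolding c_def using F that by (intro Min_le) auto
        have "(\<Sum>\<alpha>\<in>F. \<bar>a \<alpha> * t powr \<alpha>\<bar>)
            \<le> (\<Sum>\<alpha>\<in>F. \<Sum>k\<le>N c. \<bar>pcoeff (g ^ k) \<alpha> * t powr \<alpha>\<bar>)"
          using c by (intro sum_mono) (simp add: a_eq[of c "N c"] sum_distrib_right)
        also have "\<dots> = (\<Sum>k\<le>N c. \<Sum>\<alpha>\<in>F. \<bar>pcoeff (g ^ k) \<alpha> * t powr \<alpha>\<bar>)"
          by (rule sum.swap)
        also have "\<dots> \<le> (\<Sum>k\<le>N c. D ^ k)"
        proof (rule sum_mono)
          fix k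
          have "(\<Sum>\<alpha>\<in>F. \<bar>pcoeff (g ^ k) \<alpha> * t powr \<alpha>\<bar>)
              \<le> infsum (\<lambda>\<alpha>. \<bar>pcoeff (g ^ k) \<alpha> * t powr \<alpha>\<bar>) UNIV"
            by (rule finite_sum_le_infsum) (use pow[of k] F in auto)
          thus "(\<Sum>\<alpha>\<in>F. \<bar>pcoeff (g ^ k) \<alpha> * t powr \<alpha>\<bar>) \<le> D ^ k" using pow[of k] by linarith
        qed
        also have "\<dots> \<le> (\<Sum>k. D ^ k)"
          using D0 D1 by (intro sum_le_suminf) (auto intro!: summable_geometric)
        finally show "(\<Sum>\<alpha>\<in>F. \<bar>a \<alpha> * t powr \<alpha>\<bar>) \<le> (\<Sum>k. D ^ k)" .
      qed
    qed simp
  qed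
  have "is_puiseux a"
  proof (rule is_puiseuxI[OF _ \<rho>0 a_sum])
    fix c
    have "{\<alpha>. a \<alpha> \<noteq> 0 \<and> c \<le> \<alpha>} \<subseteq> (\<Union>k\<le>N c. {\<alpha>. pcoeff (g ^ k) \<alpha> \<noteq> 0 \<and> c \<le> \<alpha>})"
    proof safe
      fix \<alpha> assume "a \<alpha> \<noteq> 0" "c \<le> \<alpha>"
      hence "(\<Sum>k\<le>N c. pcoeff (g ^ k) \<alpha>) \<noteq> 0" using a_eq[of c "N c" \<alpha>] by simp
      then obtain k where "k \<in> {..N c}" "pcoeff (g ^ k) \<alpha> \<noteq> 0"
        by (meson sum.not_neutral_contains_not_neutral)
      thus "\<alpha> \<in> (\<Union>k\<le>N c. {\<alpha>. pcoeff (g ^ k) \<alpha> \<noteq> 0 \<and> c \<le> \<alpha>})" using \<open>c \<le> \<alpha>\<close> by auto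
    qed
    moreover have "finite (\<Union>k\<le>N c. {\<alpha>. pcoeff (g ^ k) \<alpha> \<noteq> 0 \<and> c \<le> \<alpha>})"
      using puiseux_fin[OF is_puiseux_pcoeff] by auto
    ultimately show "finite {\<alpha>. a \<alpha> \<noteq> 0 \<and> c \<le> \<alpha>}" by (rule finite_subset)
  qed
  then obtain h where h: "pcoeff h = a"
    using Abs_puiseux_inverse[of a] by auto
  have "(1 - g) * h = 1"
  proof (rule puiseux_eqI)
    fix \<gamma>
    let ?S = "\<Sum>k\<le>N \<gamma>. g ^ k"
    have supp: "\<alpha> \<le> 0" if "pcoeff (1 - g) \<alpha> \<noteq> 0" for \<alpha>
      using that g[of \<alpha>] \<epsilon> by (cases "pcoeff g \<alpha> = 0") (auto split: if_splits)
    have "pcoeff h (\<gamma> - \<alpha>) = pcoeff ?S (\<gamma> - \<alpha>)" if "\<alpha> \<le> 0" for \<alpha>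
      using a_eq[of \<gamma> "N \<gamma>" "\<gamma> - \<alpha>"] that by (simp add: h pcoeff_sum)
    hence eq: "pcoeff (1 - g) \<alpha> \<noteq> 0 \<Longrightarrow> pcoeff h (\<gamma> - \<alpha>) = pcoeff ?S (\<gamma> - \<alpha>)" for \<alpha>
      using supp by blast
    have "pcoeff ((1 - g) * h) \<gamma> = pcoeff ((1 - g) * ?S) \<gamma>"
      unfolding pcoeff_mult puiseux_conv_def
    proof (rule sum.cong)
      show "{\<alpha>. pcoeff (1 - g) \<alpha> \<noteq> 0 \<and> pcoeff h (\<gamma> - \<alpha>) \<noteq> 0} =
          {\<alpha>. pcoeff (1 - g) \<alpha> \<noteq> 0 \<and> pcoeff ?S (\<gamma> - \<alpha>) \<noteq> 0}"
        by (intro Collect_cong conj_cong refl) (drule eq, simp only:)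
      fix \<alpha> assume "\<alpha> \<in> {\<alpha>. pcoeff (1 - g) \<alpha> \<noteq> 0 \<and> pcoeff ?S (\<gamma> - \<alpha>) \<noteq> 0}"
      hence "pcoeff h (\<gamma> - \<alpha>) = pcoeff ?S (\<gamma> - \<alpha>)" by (intro eq) blast
      thus "pcoeff (1 - g) \<alpha> * pcoeff h (\<gamma> - \<alpha>) = pcoeff (1 - g) \<alpha> * pcoeff ?S (\<gamma> - \<alpha>)"
        by (simp only:)
    qed
    also have "(1 - g) * ?S = 1 - g ^ Suc (N \<gamma>)"
      using sum_gp_basic[of g "N \<gamma>"] by simp
    also have "pcoeff \<dots> \<gamma> = pcoeff 1 \<gamma>"
      using N[of \<gamma> "Suc (N \<gamma>)" \<gamma>] by (simp del: power_Suc)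
    finally show "pcoeff ((1 - g) * h) \<gamma> = pcoeff 1 \<gamma>" .
  qed
  thus ?thesis ..
qed

lemma puiseux_inverse_exists:
  fixes f :: puiseux
  assumes "f \<noteq> 0"
  shows "\<exists>h. h * f = 1"
proof -
  define \<delta> where "\<delta> = lead_exp f"
  define r where "r = pcoeff f \<delta>"
  have r: "r \<noteq> 0" and le: "\<And>\<alpha>. pcoeff f \<alpha> \<noteq> 0 \<Longrightarrow> \<alpha> \<le> \<delta>"
    using lead_exp[OF assms] by (auto simp: r_def \<delta>_def)
  define g where "g = 1 - monomial (1 / r) (- \<delta>) * f"
  have cg: "pcoeff g \<alpha> = (if \<alpha> = 0 then 0 else - (pcoeff f (\<alpha> + \<delta>) / r))" for \<alpha>
    using r by (auto simp: g_def pcoeff_monomial_mult r_def)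
  have neg: "\<alpha> < 0" if "pcoeff g \<alpha> \<noteq> 0" for \<alpha>
    using that le[of "\<alpha> + \<delta>"] by (auto simp: cg split: if_splits)
  have "\<exists>\<epsilon>>0. \<forall>\<alpha>. pcoeff g \<alpha> \<noteq> 0 \<longrightarrow> \<alpha> \<le> - \<epsilon>"
  proof (cases "g = 0")
    case True thus ?thesis by (intro exI[of _ 1]) auto
  next
    case False
    thus ?thesis using lead_exp[OF False] neg by (intro exI[of _ "- lead_exp g"]) auto
  qed
  then obtain \<epsilon> where "\<epsilon> > 0" "\<And>\<alpha>. pcoeff g \<alpha> \<noteq> 0 \<Longrightarrow> \<alpha> \<le> - \<epsilon>" by blast
  then obtain h where "(1 - g) * h = 1" using puiseux_geometric by blast
  hence "(h * monomial (1 / r) (- \<delta>)) * f = 1" by (simp add: g_def mult_ac)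
  thus ?thesis ..
qed

instantiation puiseux :: linordered_field
begin

definition inverse_puiseux :: "puiseux \<Rightarrow> puiseux" where
  "inverse (f :: puiseux) = (if f = 0 then 0 else (THE h. h * f = 1))"

definition divide_puiseux :: "puiseux \<Rightarrow> puiseux \<Rightarrow> puiseux" where
  "f div g = f * inverse (g :: puiseux)"

instance
proof
  fix f g :: puiseux
  show "f \<noteq> 0 \<Longrightarrow> inverse f * f = 1"
  proof -
    assume f: "f \<noteq> 0"
    obtain h where h: "h * f = 1" using puiseux_inverse_exists[OF f] by blast
    have "(THE h. h * f = 1) * f = 1"
      by (rule theI[of _ h]) (use h f in \<open>metis mult_right_cancel\<close>)+
    thus ?thesis using f by (simp add: inverse_puiseux_def)
  qed
  show "f div g = f * inverse g" by (simp add: divide_puiseux_def)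
  show "inverse (0 :: puiseux) = 0" by (simp add: inverse_puiseux_def)
qed

end

section \<open>Valuation\<close>

definition val :: "puiseux \<Rightarrow> ereal" where
  "val f = (if f = 0 then -\<infinity> else ereal (lead_exp f))"

section \<open>Primal-dual feasible set, central path and tropical duality gap\<close>

text \<open>
  A point is a quadruple \<open>(x, w, s, y)\<close>, with \<open>x\<close>, \<open>s\<close> indexed by \<open>'n\<close> and \<open>w\<close>, \<open>y\<close> by \<open>'m\<close>.
\<close>

type_synonym ('k, 'n, 'm) pdpoint = "('k ^ 'n) \<times> ('k ^ 'm) \<times> ('k ^ 'n) \<times> ('k ^ 'm)"

definition feasible ::
  "puiseux ^ 'n ^ 'm \<Rightarrow> puiseux ^ 'm \<Rightarrow> puiseux ^ 'n \<Rightarrow> (puiseux, 'n, 'm) pdpoint set"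
where
  "feasible A b c = {(x, w, s, y).
     (\<forall>j. 0 \<le> x $ j) \<and> (\<forall>i. 0 \<le> w $ i) \<and> (\<forall>j. 0 \<le> s $ j) \<and> (\<forall>i. 0 \<le> y $ i) \<and>
     A *v x + w = b \<and> s - transpose A *v y = c}"

definition strictly_feasible ::
  "puiseux ^ 'n ^ 'm \<Rightarrow> puiseux ^ 'm \<Rightarrow> puiseux ^ 'n \<Rightarrow> (puiseux, 'n, 'm) pdpoint set"
where
  "strictly_feasible A b c = {(x, w, s, y) \<in> feasible A b c.
     (\<forall>j. 0 < x $ j) \<and> (\<forall>i. 0 < w $ i) \<and> (\<forall>j. 0 < s $ j) \<and> (\<forall>i. 0 < y $ i)}"

definition is_central_point ::
  "puiseux ^ 'n ^ 'm \<Rightarrow> puiseux ^ 'm \<Rightarrow> puiseux ^ 'n \<Rightarrow> puiseux \<Rightarrow> (puiseux, 'n, 'm) pdpoint \<Rightarrow> bool"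
where
  "is_central_point A b c \<mu> z \<longleftrightarrow> z \<in> strictly_feasible A b c \<and>
     (case z of (x, w, s, y) \<Rightarrow> (\<forall>j. x $ j * s $ j = \<mu>) \<and> (\<forall>i. w $ i * y $ i = \<mu>))"

definition val_vec :: "puiseux ^ 'n \<Rightarrow> ereal ^ 'n" where
  "val_vec x = (\<chi> j. val (x $ j))"

definition val_point :: "(puiseux, 'n::finite, 'm::finite) pdpoint \<Rightarrow> (ereal, 'n, 'm) pdpoint" where
  "val_point = (\<lambda>(x, w, s, y). (val_vec x, val_vec w, val_vec s, val_vec y))"

text \<open>
  Valuations never take the value \<open>\<infinity>\<close>, so on images of the valuation the sums below are
  those of \<open>\<real> \<union> {-\<infinity>}\<close>.
\<close>

definition tgap :: "(ereal, 'n::finite, 'm::finite) pdpoint \<Rightarrow> ereal" where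
  "tgap = (\<lambda>(x, w, s, y).
     max (Max (range (\<lambda>j. x $ j + s $ j))) (Max (range (\<lambda>i. w $ i + y $ i))))"

text \<open>
  The barycenter is the coordinatewise maximum, which is required to belong to the set; the
  library orders on vectors and products are componentwise.
\<close>

definition is_barycenter ::
  "(ereal, 'n::finite, 'm::finite) pdpoint set \<Rightarrow> (ereal, 'n, 'm) pdpoint \<Rightarrow> bool"
where
  "is_barycenter S z \<longleftrightarrow> z \<in> S \<and> (\<forall>z'\<in>S. z' \<le> z)"

end

(*
  Feasible directions are orthogonal: for z, z' in the affine space of the primal-dual problem,
  <x' - x, s' - s> + <w' - w, y' - y> = 0. If z is the central point with parameter mu, expanding gives
    <x', s> + <x, s'> + <w', y> + <w, y'> = N mu + <x', s'> + <w', y'>.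
  All terms are nonnegative, so there is no cancellation on the left and each product there, for
  instance x'_j s_j, has valuation at most that of the right-hand side. The latter is at most val mu
  as soon as tgap (val z') <= val mu. Since x_j s_j = mu, this says val x'_j <= val x_j.
*)
theory Submission
  imports Defs
begin

text \<open>Recasts a valuation bound as a linear condition on coefficients, hence one that is
  visibly stable under addition.\<close>

lemma val_le_ereal_iff: "val f \<le> ereal v \<longleftrightarrow> (\<forall>\<alpha>>v. pcoeff f \<alpha> = 0)"
proof (cases "f = 0")
  case False
  show ?thesis
    using lead_exp[OF False] False by (auto simp: val_def) (meson not_le order.trans)+
qed (simp add: val_def)

lemma val_add_le: "val f \<le> v \<Longrightarrow> val g \<le> v \<Longrightarrow> val (f + g) \<le> v"
proof (cases v)
  case (real r)
  assume "val f \<le> v" "val g \<le> v"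
  thus ?thesis by (simp add: real val_le_ereal_iff)
\<comment> \<open>The bound \<open>-\<infinity>\<close> forces both series to vanish, and the bound
  \<open>\<infinity>\<close> is trivial.\<close>
qed (auto simp: val_def split: if_splits)

lemma val_sum_le: "(\<And>i. i \<in> I \<Longrightarrow> val (f i) \<le> v) \<Longrightarrow> val (sum f I) \<le> v"
  by (induction I rule: infinite_finite_induct) (simp_all add: val_add_le, simp_all add: val_def)

text \<open>The leading coefficients multiply to a nonzero real. With a zero factor both sides are
  \<open>-\<infinity>\<close>, since \<open>val\<close> never takes the value
  \<open>\<infinity>\<close>.\<close>

lemma val_mult: "val (f * g) = val f + val g"
proof (cases "f = 0 \<or> g = 0")
  case False
  hence f: "f \<noteq> 0" and g: "g \<noteq> 0" by auto
  note F = lead_exp[OF f] and G = lead_exp[OF g]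
  have F0: "pcoeff f \<alpha> = 0" if "\<alpha> > lead_exp f" for \<alpha> using F(2)[of \<alpha>] that by auto
  have G0: "pcoeff g \<alpha> = 0" if "\<alpha> > lead_exp g" for \<alpha> using G(2)[of \<alpha>] that by auto
  have "lead_exp (f * g) = lead_exp f + lead_exp g"
    using pcoeff_mult_lead[OF F0 G0] F(1) G(1) by (intro lead_exp_eqI) auto
  thus ?thesis using f g by (simp add: val_def)
qed (auto simp: val_def)

text \<open>If \<open>val g\<close> were smaller than \<open>val f\<close>, then
  \<open>f - g\<close> would inherit the leading term of \<open>f\<close>, which is positive,
  contradicting \<open>f \<le> g\<close>.\<close>

lemma val_mono:
  assumes "0 \<le> f" "f \<le> g"
  shows "val f \<le> val g"
proof (rule ccontr)
  assume *: "\<not> val f \<le> val g"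
  hence f: "f \<noteq> 0" by (auto simp: val_def)
  have "puiseux_pos f" using assms(1) f by (auto simp: less_eq_puiseux_def)
  hence pos: "pcoeff f (lead_exp f) > 0" by (simp add: puiseux_pos_def)
  have f0: "pcoeff f \<alpha> = 0" if "\<alpha> > lead_exp f" for \<alpha> using lead_exp(2)[OF f, of \<alpha>] that by auto
  have g0: "pcoeff g \<alpha> = 0" if "\<alpha> \<ge> lead_exp f" for \<alpha>
  proof (cases "g = 0")
    case False
    thus ?thesis using lead_exp(2)[OF False, of \<alpha>] * f that by (force simp: val_def)
  qed simp
  have "puiseux_pos (f - g)"
    unfolding puiseux_pos_iff using pos f0 g0 by (intro exI[of _ "lead_exp f"]) auto
  hence "g < f" by (simp add: less_puiseux_def)
  thus False using assms(2) by simp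
qed

text \<open>Here \<open>x\<close> and \<open>q\<close> stand for complementary coordinates of the
  central point and \<open>p\<close> for a coordinate of another feasible point. As
  \<open>x * q\<close> is nonzero, \<open>val q\<close> is finite and cancels.\<close>

lemma val_le_of_mult_le:
  assumes "0 \<le> p" "x * q = \<mu>" "0 < \<mu>" "p * q \<le> R" "0 \<le> q" "val R \<le> val \<mu>"
  shows "val p \<le> val x"
proof -
  have "val p + val q \<le> val x + val q"
    using val_mono[of "p * q" R] assms by (simp add: val_mult[symmetric] order.trans)
  moreover have "q \<noteq> 0" using assms by auto
  ultimately show ?thesis by (cases "val p"; cases "val x") (auto simp: val_def split: if_splits)
qed

lemma inner_transpose:
  fixes A :: "'a::comm_ring_1 ^ 'n ^ 'm"
  shows "(\<Sum>j\<in>UNIV. u $ j * (transpose A *v v) $ j) = (\<Sum>i\<in>UNIV. (A *v u) $ i * v $ i)"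
proof -
  have "(\<Sum>j\<in>UNIV. u $ j * (transpose A *v v) $ j) = (\<Sum>j\<in>UNIV. \<Sum>i\<in>UNIV. A $ i $ j * u $ j * v $ i)"
    by (simp add: matrix_vector_mult_def transpose_def sum_distrib_left mult_ac)
  also have "\<dots> = (\<Sum>i\<in>UNIV. \<Sum>j\<in>UNIV. A $ i $ j * u $ j * v $ i)"
    by (rule sum.swap)
  finally show ?thesis
    by (simp add: matrix_vector_mult_def sum_distrib_right)
qed

text \<open>With dx and dy the differences of the \<open>x\<close> and \<open>y\<close> blocks, the
  constraints give dw = -A dx and ds = A^T dy, so the two sums are <A dx, dy> and its
  negative.\<close>

lemma feasible_directions_orthogonal:
  assumes "(x, w, s, y) \<in> feasible A b c" "(x', w', s', y') \<in> feasible A b c"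
  shows "(\<Sum>j\<in>UNIV. (x' $ j - x $ j) * (s' $ j - s $ j)) +
    (\<Sum>i\<in>UNIV. (w' $ i - w $ i) * (y' $ i - y $ i)) = 0"
proof -
  have "s' - s = transpose A *v (y' - y)"
    using assms by (auto simp: feasible_def matrix_vector_mult_diff_distrib algebra_simps)
  hence s: "s' $ j - s $ j = (transpose A *v (y' - y)) $ j" for j
    by (simp flip: vector_minus_component)
  have "w' - w = - (A *v (x' - x))"
    using assms by (auto simp: feasible_def matrix_vector_mult_diff_distrib algebra_simps)
  hence w: "w' $ i - w $ i = - ((A *v (x' - x)) $ i)" for i
    by (simp flip: vector_minus_component)
  show ?thesis
    using inner_transpose[of "x' - x" A "y' - y"] by (simp add: s w sum_negf)
qed

lemma tgap_val_le_iff: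
  "tgap (val_point (x, w, s, y)) \<le> v \<longleftrightarrow>
    (\<forall>j. val (x $ j * s $ j) \<le> v) \<and> (\<forall>i. val (w $ i * y $ i) \<le> v)"
  by (simp add: tgap_def val_point_def val_vec_def val_mult)

theorem theorem15:
  fixes A :: "puiseux ^ 'n ^ 'm" and b :: "puiseux ^ 'm" and c :: "puiseux ^ 'n"
    and \<mu> :: puiseux and z :: "(puiseux, 'n, 'm) pdpoint"
  assumes "strictly_feasible A b c \<noteq> {}"
    and "\<mu> > 0"
    and "is_central_point A b c \<mu> z"
  shows "is_barycenter {u \<in> val_point ` feasible A b c. tgap u \<le> val \<mu>} (val_point z)"
proof -
  obtain x w s y where z: "z = (x, w, s, y)" by (cases z)
  have F: "(x, w, s, y) \<in> feasible A b c"
    and xs: "\<And>j. x $ j * s $ j = \<mu>" and wy: "\<And>i. w $ i * y $ i = \<mu>"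
    using assms(3) by (auto simp: z is_central_point_def strictly_feasible_def)
  have nonneg: "\<And>j. 0 \<le> x $ j" "\<And>i. 0 \<le> w $ i" "\<And>j. 0 \<le> s $ j" "\<And>i. 0 \<le> y $ i"
    using F by (auto simp: feasible_def)
  have "val_point z' \<le> val_point z"
    if F': "z' \<in> feasible A b c" and gap: "tgap (val_point z') \<le> val \<mu>" for z'
  proof -
    obtain x' w' s' y' where z': "z' = (x', w', s', y')" by (cases z')
    have nonneg': "\<And>j. 0 \<le> x' $ j" "\<And>i. 0 \<le> w' $ i" "\<And>j. 0 \<le> s' $ j" "\<And>i. 0 \<le> y' $ i"
      using F' by (auto simp: z' feasible_def)
    \<comment> \<open>The unmixed products of the expanded orthogonality relation; those of the
      central point all equal \<open>\<mu>\<close>.\<close>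
    define R where "R = (\<Sum>j\<in>UNIV. x' $ j * s' $ j + x $ j * s $ j) +
      (\<Sum>i\<in>UNIV. w' $ i * y' $ i + w $ i * y $ i)"
    have R: "val R \<le> val \<mu>"
      using gap unfolding R_def z' tgap_val_le_iff
      by (intro val_add_le val_sum_le) (auto simp: xs wy)
    \<comment> \<open>The mixed products, grouped by coordinate, each with its primed factor first
      to match \<open>p * q\<close> in \<open>val_le_of_mult_le\<close>.\<close>
    define P where "P = (\<lambda>j. x' $ j * s $ j + s' $ j * x $ j)"
    define Q where "Q = (\<lambda>i. w' $ i * y $ i + y' $ i * w $ i)"
    have "sum P UNIV + sum Q UNIV = R"
      using feasible_directions_orthogonal[OF F F'[unfolded z']]
      by (simp add: P_def Q_def R_def algebra_simps sum.distrib sum_subtractf)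
    moreover have P0: "0 \<le> P j" and Q0: "0 \<le> Q i" for j i
      unfolding P_def Q_def using nonneg nonneg' by auto
    moreover have "P j \<le> sum P UNIV" "Q i \<le> sum Q UNIV" for j i
      using P0 Q0 by (auto intro!: member_le_sum)
    moreover have "0 \<le> sum P UNIV" "0 \<le> sum Q UNIV"
      using P0 Q0 by (auto intro!: sum_nonneg)
    ultimately have PR: "P j \<le> R" and QR: "Q i \<le> R" for j i
      by (metis add_increasing2, metis add_increasing)
    have le: "x' $ j * s $ j \<le> P j" "s' $ j * x $ j \<le> P j"
      "w' $ i * y $ i \<le> Q i" "y' $ i * w $ i \<le> Q i" for j i
      unfolding P_def Q_def using nonneg nonneg' by auto
    have "val (x' $ j) \<le> val (x $ j)" for j
      by (rule val_le_of_mult_le[OF _ xs[of j] assms(2) order.trans[OF le(1) PR] _ R])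
        (use nonneg nonneg' in auto)
    \<comment> \<open>Same argument with the roles of \<open>x\<close> and \<open>s\<close>
      exchanged, which is why commutativity enters.\<close>
    moreover have "val (s' $ j) \<le> val (s $ j)" for j
      by (rule val_le_of_mult_le[OF _ _ assms(2) order.trans[OF le(2) PR] _ R])
        (use nonneg nonneg' xs[of j] in \<open>auto simp: mult.commute\<close>)
    moreover have "val (w' $ i) \<le> val (w $ i)" for i
      by (rule val_le_of_mult_le[OF _ wy[of i] assms(2) order.trans[OF le(3) QR] _ R])
        (use nonneg nonneg' in auto)
    moreover have "val (y' $ i) \<le> val (y $ i)" for i
      by (rule val_le_of_mult_le[OF _ _ assms(2) order.trans[OF le(4) QR] _ R])
        (use nonneg nonneg' wy[of i] in \<open>auto simp: mult.commute\<close>)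
    ultimately show ?thesis
      by (simp add: z z' val_point_def val_vec_def less_eq_vec_def)
  qed
  \<comment> \<open>Membership of the central point: each of its complementary products is exactly
    \<open>\<mu>\<close>.\<close>
  moreover have "tgap (val_point z) \<le> val \<mu>"
    by (simp add: z tgap_val_le_iff xs wy)
  ultimately show ?thesis
    using F by (auto simp: is_barycenter_def z)
qed

end
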